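(* Let $x \in \mathbb{R}^d$ and let $\mathbf{f} = (\mathbf{f}_0, \mathbf{f}_1): \mathbb{R}^d \to \mathbb{R}^2$ have twice continuously differentiable components. Suppose $\mathbf{f}_0(x) > \mathbf{f}_1(x)$ and define $f = \mathbf{f}_0 - \mathbf{f}_1$. Let $H_f : \mathbb{R}^d \to \mathbb{R}^{d\times d}$ denote the Hessian of $f$. Let $p, q \in [1,\infty]$ satisfy $\frac1p + \frac1q = 1$. For every $\delta \in \mathbb{R}^d$, if $\mathbf{f}_1(x+\delta) \ge \mathbf{f}_0(x+\delta)$, then $$\|\delta\|_p \ \ge\ \max_{R>0}\ \min\left\{ R,\ \frac{f(x)}{\|\nabla f(x)\|_q + \frac{R}{2} K_R(f,x)} \right\},$$ where $K_R(f,x) = \max_{\|\gamma\|_p \le R} \|H_f(x+\gamma)\|_{p\to q}$.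
   Context: For $r \in [1,\infty]$, $\|\cdot\|_r$ is the $\ell_r$ norm on $\mathbb{R}^d$. For a matrix $H \in \mathbb{R}^{d\times d}$, the operator norm is $\|H\|_{p\to q} := \sup\{\|Hv\|_q : v \in \mathbb{R}^d,\ \|v\|_p = 1\}$. The function $\mathbf{f}$ is the scoring function of a binary classifier, which predicts the class whose component of $\mathbf{f}$ is largest. Convention: a quotient whose denominator is $0$ is interpreted as $+\infty$. *)

theory Defs
  imports "HOL-Analysis.Analysis"
begin

definition lp_norm :: "ereal \<Rightarrow> real ^ 'd \<Rightarrow> real" where
  "lp_norm r v =
    (if r = \<infinity> then infnorm v
     else (\<Sum>i\<in>UNIV. \<bar>v $ i\<bar> powr real_of_ereal r) powr (1 / real_of_ereal r))"

definition op_norm :: "ereal \<Rightarrow> ereal \<Rightarrow> real ^ 'd ^ 'd \<Rightarrow> real" where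
  "op_norm p q H = (SUP v\<in>{v. lp_norm p v = 1}. lp_norm q (H *v v))"

definition gradient :: "(real ^ 'd \<Rightarrow> real) \<Rightarrow> real ^ 'd \<Rightarrow> real ^ 'd" where
  "gradient g y = (\<chi> i. frechet_derivative g (at y) (axis i 1))"

definition hessian :: "(real ^ 'd \<Rightarrow> real) \<Rightarrow> real ^ 'd \<Rightarrow> real ^ 'd ^ 'd" where
  "hessian g y = jacobian (gradient g) (at y)"

text \<open>The two differentiability conditions matter: without them \<^const>\<open>frechet_derivative\<close>
  is an unspecified choice, and continuity of \<^const>\<open>hessian\<close> alone would say nothing.\<close>

definition twice_continuously_differentiable :: "(real ^ 'd \<Rightarrow> real) \<Rightarrow> bool" where
  "twice_continuously_differentiable g \<longleftrightarrow>
    g differentiable_on UNIV \<and> gradient g differentiable_on UNIV \<and> continuous_on UNIV (hessian g)"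

text \<open>The supremum below is a maximum for every twice continuously differentiable function; see
  \<open>curvature_attained\<close>.\<close>

definition curvature :: "ereal \<Rightarrow> ereal \<Rightarrow> real \<Rightarrow> (real ^ 'd \<Rightarrow> real) \<Rightarrow> real ^ 'd \<Rightarrow> real" where
  "curvature p q R g x = (SUP \<gamma>\<in>{\<gamma>. lp_norm p \<gamma> \<le> R}. op_norm p q (hessian g (x + \<gamma>)))"

text \<open>Division of extended reals sends a positive number divided by zero to \<open>\<infinity>\<close>, so no
  separate case is needed for a vanishing denominator when \<open>g x > 0\<close>.\<close>

definition radius_bound :: "ereal \<Rightarrow> ereal \<Rightarrow> (real ^ 'd \<Rightarrow> real) \<Rightarrow> real ^ 'd \<Rightarrow> real \<Rightarrow> ereal" where
  "radius_bound p q g x R =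
    min (ereal R)
      (ereal (g x) / ereal (lp_norm q (gradient g x) + R / 2 * curvature p q R g x))"

lemma ereal_ge_1_cases:
  assumes "(1::ereal) \<le> r"
  obtains "r = \<infinity>" | s where "r = ereal s" "1 \<le> s"
  using assms by (cases r) auto

lemma continuous_on_lp_norm:
  fixes f :: "'a::topological_space \<Rightarrow> real ^ 'd"
  assumes "1 \<le> r" "continuous_on S f"
  shows "continuous_on S (\<lambda>z. lp_norm r (f z))"
  using assms(1)
proof (cases rule: ereal_ge_1_cases)
  case 1
  have "continuous_on UNIV (infnorm :: real ^ 'd \<Rightarrow> real)"
    by (intro continuous_at_imp_continuous_on ballI continuous_infnorm continuous_ident)
  with assms(2) show ?thesis
    by (auto simp: lp_norm_def 1 intro: continuous_on_compose2)
next
  case (2 s)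
  have sum: "continuous_on S (\<lambda>z. \<Sum>i\<in>UNIV. \<bar>f z $ i\<bar> powr s)"
    using 2 by (intro continuous_on_sum continuous_on_powr' continuous_intros assms) auto
  have "continuous_on S (\<lambda>z. (\<Sum>i\<in>UNIV. \<bar>f z $ i\<bar> powr s) powr (1 / s))"
    using 2 by (intro continuous_on_powr' sum continuous_on_const) (auto intro: sum_nonneg)
  then show ?thesis
    using 2 by (simp add: lp_norm_def)
qed

lemma component_le_lp_norm:
  assumes "1 \<le> r"
  shows "\<bar>v $ i\<bar> \<le> lp_norm r v"
  using assms
proof (cases rule: ereal_ge_1_cases)
  case 1
  then show ?thesis by (simp add: lp_norm_def component_le_infnorm_cart)
next
  case (2 s)
  have "\<bar>v $ i\<bar> powr s \<le> (\<Sum>i\<in>UNIV. \<bar>v $ i\<bar> powr s)"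
    by (rule member_le_sum) auto
  then have "(\<bar>v $ i\<bar> powr s) powr (1 / s) \<le> (\<Sum>i\<in>UNIV. \<bar>v $ i\<bar> powr s) powr (1 / s)"
    using 2 by (intro powr_mono2) auto
  then show ?thesis
    using 2 by (simp add: lp_norm_def powr_powr)
qed

lemma lp_norm_axis:
  fixes i :: "'d::finite"
  assumes "1 \<le> r"
  shows "lp_norm r (axis i 1) = 1"
  using assms
proof (cases rule: ereal_ge_1_cases)
  case 1
  have "{\<bar>axis i (1::real) $ j\<bar> |j. j \<in> UNIV} = (\<lambda>j. if j = i then 1 else 0) ` UNIV"
    by (auto simp: axis_def image_def)
  moreover have "Sup ((\<lambda>j. if j = i then 1 else (0::real)) ` UNIV) = 1"
    by (rule cSup_eq_maximum) auto
  ultimately show ?thesis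
    by (simp add: lp_norm_def 1 infnorm_cart)
next
  case (2 s)
  have "(\<Sum>j\<in>UNIV. \<bar>axis i (1::real) $ j\<bar> powr s) = (\<Sum>j\<in>UNIV. if j = i then 1 else 0)"
    using 2 by (intro sum.cong) (auto simp: axis_def)
  then show ?thesis
    using 2 by (simp add: lp_norm_def)
qed

lemma lp_norm_zero: "1 \<le> r \<Longrightarrow> lp_norm r 0 = 0"
  by (erule ereal_ge_1_cases) (auto simp: lp_norm_def infnorm_0)

lemma bounded_lp_norm:
  assumes "1 \<le> r" "\<And>v. v \<in> S \<Longrightarrow> lp_norm r (v :: real ^ 'd) \<le> R"
  shows "bounded S"
proof -
  have "norm v \<le> (\<Sum>i\<in>(UNIV::'d set). R)" if "v \<in> S" for v
  proof -
    have "norm v \<le> (\<Sum>i\<in>UNIV. \<bar>v $ i\<bar>)" by (rule norm_le_l1_cart)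
    also have "\<dots> \<le> (\<Sum>i\<in>(UNIV::'d set). R)"
      by (intro sum_mono order_trans[OF component_le_lp_norm[OF assms(1)]] assms(2) that)
    finally show ?thesis .
  qed
  then show ?thesis by (auto simp: bounded_iff)
qed

lemma compact_lp_ball:
  assumes "1 \<le> r" shows "compact {v :: real ^ 'd. lp_norm r v \<le> R}"
proof -
  have "closed {v :: real ^ 'd. lp_norm r v \<le> R}"
    by (intro closed_Collect_le continuous_on_lp_norm assms continuous_intros)
  then show ?thesis
    using assms by (auto simp: compact_eq_bounded_closed intro: bounded_lp_norm)
qed

lemma compact_lp_sphere:
  assumes "1 \<le> r" shows "compact {v :: real ^ 'd. lp_norm r v = 1}"
proof -
  have "closed {v :: real ^ 'd. lp_norm r v = 1}"
    by (intro closed_Collect_eq continuous_on_lp_norm assms continuous_intros)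
  then show ?thesis
    using assms by (auto simp: compact_eq_bounded_closed intro: bounded_lp_norm[where R = 1])
qed

lemma op_norm_attained:
  fixes H :: "real ^ 'd ^ 'd"
  assumes "1 \<le> p" "1 \<le> q"
  shows "\<exists>v. lp_norm p v = 1 \<and> lp_norm q (H *v v) = op_norm p q H"
    and "lp_norm p v = 1 \<Longrightarrow> lp_norm q (H *v v) \<le> op_norm p q H"
proof -
  let ?S = "{v :: real ^ 'd. lp_norm p v = 1}"
  have ne: "?S \<noteq> {}"
    using lp_norm_axis[OF assms(1)] by auto
  have cont: "continuous_on ?S (\<lambda>v. lp_norm q (H *v v))"
    by (intro continuous_on_lp_norm assms continuous_intros)
  obtain w where w: "w \<in> ?S" "\<And>v. v \<in> ?S \<Longrightarrow> lp_norm q (H *v v) \<le> lp_norm q (H *v w)"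
    using continuous_attains_sup[OF compact_lp_sphere[OF assms(1)] ne cont] by blast
  have eq: "op_norm p q H = lp_norm q (H *v w)"
    unfolding op_norm_def using w by (intro cSup_eq_maximum) auto
  show "\<exists>v. lp_norm p v = 1 \<and> lp_norm q (H *v v) = op_norm p q H"
    using w(1) eq by auto
  show "lp_norm p v = 1 \<Longrightarrow> lp_norm q (H *v v) \<le> op_norm p q H"
    using w(2)[of v] eq by simp
qed

lemma curvature_attained:
  fixes g :: "real ^ 'd \<Rightarrow> real"
  assumes "1 \<le> p" "1 \<le> q" "0 \<le> R" "twice_continuously_differentiable g"
  shows "\<exists>\<gamma>. lp_norm p \<gamma> \<le> R \<and> op_norm p q (hessian g (x + \<gamma>)) = curvature p q R g x"
    and "lp_norm p \<gamma> \<le> R \<Longrightarrow> op_norm p q (hessian g (x + \<gamma>)) \<le> curvature p q R g x"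
proof -
  let ?B = "{\<gamma> :: real ^ 'd. lp_norm p \<gamma> \<le> R}"
  let ?S = "{v :: real ^ 'd. lp_norm p v = 1}"
  let ?h = "\<lambda>z. lp_norm q (hessian g (x + fst z) *v snd z)"
  have "(0, axis undefined 1) \<in> ?B \<times> ?S"
    by (simp add: lp_norm_axis lp_norm_zero assms)
  then have ne: "?B \<times> ?S \<noteq> {}"
    by blast
  have hess: "continuous_on UNIV (hessian g)"
    using assms(4) by (simp add: twice_continuously_differentiable_def)
  have entry: "continuous_on (?B \<times> ?S) (\<lambda>z. hessian g (x + fst z))"
    by (rule continuous_on_compose2[OF hess]) (auto intro!: continuous_intros)
  have "continuous_on (?B \<times> ?S) (\<lambda>z. hessian g (x + fst z) *v snd z)"
    unfolding matrix_vector_mult_def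
    by (intro continuous_on_vec_lambda continuous_intros entry)
  then have cont: "continuous_on (?B \<times> ?S) ?h"
    by (rule continuous_on_lp_norm[OF assms(2)])
  obtain z where z: "z \<in> ?B \<times> ?S" "\<And>y. y \<in> ?B \<times> ?S \<Longrightarrow> ?h y \<le> ?h z"
    using continuous_attains_sup[OF compact_Times[OF compact_lp_ball compact_lp_sphere] ne cont]
      assms(1) by blast
  have le: "op_norm p q (hessian g (x + \<gamma>)) \<le> op_norm p q (hessian g (x + fst z))"
    if "lp_norm p \<gamma> \<le> R" for \<gamma>
  proof -
    obtain v where v: "lp_norm p v = 1"
        "lp_norm q (hessian g (x + \<gamma>) *v v) = op_norm p q (hessian g (x + \<gamma>))"
      using op_norm_attained(1)[OF assms(1,2)] by blast
    have "op_norm p q (hessian g (x + \<gamma>)) \<le> ?h z"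
      using z(2)[of "(\<gamma>, v)"] v that by simp
    also have "\<dots> \<le> op_norm p q (hessian g (x + fst z))"
      using z(1) by (intro op_norm_attained(2)[OF assms(1,2)]) auto
    finally show ?thesis .
  qed
  have eq: "curvature p q R g x = op_norm p q (hessian g (x + fst z))"
    unfolding curvature_def using le z(1) by (intro cSup_eq_maximum) auto
  show "\<exists>\<gamma>. lp_norm p \<gamma> \<le> R \<and> op_norm p q (hessian g (x + \<gamma>)) = curvature p q R g x"
    using z(1) eq by auto
  show "lp_norm p \<gamma> \<le> R \<Longrightarrow> op_norm p q (hessian g (x + \<gamma>)) \<le> curvature p q R g x"
    using le[of \<gamma>] eq by simp
qed

end

theory Submission
  imports Defs
begin

text \<open>Put \<open>r = lp_norm p \<delta>\<close>. A second-order Taylor expansion along the segment from \<open>x\<close> to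
  \<open>x + \<delta>\<close>, with Hoelder's inequality for the linear and the quadratic term, yields
  \<open>f x \<le> r * D r\<close>, where \<open>D R\<close> is the denominator in the bound at radius \<open>R\<close>. Since \<open>D\<close> is
  nondecreasing, \<open>min R (f x / D R)\<close> is maximal at the largest \<open>R \<le> r\<close> with
  \<open>R * D R \<le> f x\<close>, and its value there is \<open>R\<close> itself. In particular the misclassified point \<open>x + \<delta>\<close>
  is what makes the maximum exist: for constant \<open>f\<close> the bound would be unbounded in \<open>R\<close>.\<close>

section \<open>Hoelder's inequality\<close>

lemma lp_norm_nonneg: "1 \<le> r \<Longrightarrow> 0 \<le> lp_norm r v"
  using component_le_lp_norm[of r v undefined] by linarith

lemma lp_norm_scaleR:
  assumes "1 \<le> r"
  shows "lp_norm r (c *\<^sub>R v) = \<bar>c\<bar> * lp_norm r v"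
  using assms
proof (cases rule: ereal_ge_1_cases)
  case 1
  then show ?thesis by (simp add: lp_norm_def infnorm_mul)
next
  case (2 s)
  have "(\<Sum>i\<in>UNIV. \<bar>(c *\<^sub>R v) $ i\<bar> powr s) = \<bar>c\<bar> powr s * (\<Sum>i\<in>UNIV. \<bar>v $ i\<bar> powr s)"
    by (simp add: sum_distrib_left abs_mult powr_mult)
  then show ?thesis
    using 2 by (simp add: lp_norm_def powr_mult powr_powr sum_nonneg)
qed

lemma lp_norm_eq_0_iff:
  assumes "1 \<le> r"
  shows "lp_norm r v = 0 \<longleftrightarrow> v = 0"
proof
  assume "lp_norm r v = 0"
  then show "v = 0"
    using component_le_lp_norm[OF assms, of v] by (simp add: vec_eq_iff)
qed (simp add: lp_norm_zero[OF assms])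

lemma lp_norm_normalize:
  assumes "1 \<le> r" "v \<noteq> 0"
  shows "lp_norm r ((1 / lp_norm r v) *\<^sub>R v) = 1"
  using assms lp_norm_eq_0_iff[of r v] lp_norm_nonneg[of r v]
  by (simp add: lp_norm_scaleR)

text \<open>The endpoint case, outside the reach of Young's inequality: bounding each component of
  \<open>w\<close> by its maximum norm leaves the 1-norm of \<open>v\<close>.\<close>

lemma Hoelder_one_infinity:
  fixes v w :: "real ^ 'd"
  shows "v \<bullet> w \<le> lp_norm 1 v * lp_norm \<infinity> w"
proof -
  have "v \<bullet> w \<le> (\<Sum>i\<in>UNIV. \<bar>v $ i\<bar> * lp_norm \<infinity> w)"
    unfolding inner_vec_def
  proof (rule sum_mono)
    fix i :: 'd
    have "v $ i \<bullet> w $ i \<le> \<bar>v $ i\<bar> * \<bar>w $ i\<bar>"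
      by (simp flip: abs_mult)
    also have "\<dots> \<le> \<bar>v $ i\<bar> * lp_norm \<infinity> w"
      by (intro mult_left_mono component_le_lp_norm) auto
    finally show "v $ i \<bullet> w $ i \<le> \<bar>v $ i\<bar> * lp_norm \<infinity> w" .
  qed
  then show ?thesis
    by (simp add: lp_norm_def sum_distrib_right sum_nonneg flip: one_ereal_def)
qed

text \<open>Removes the outer root, so that the power sums coming from Young's inequality can be
  evaluated.\<close>

lemma sum_powr_eq_1_if_lp_norm_eq_1:
  fixes v :: "real ^ 'd"
  assumes "lp_norm (ereal s) v = 1" "0 < s"
  shows "(\<Sum>i\<in>UNIV. \<bar>v $ i\<bar> powr s) = 1"
proof -
  let ?S = "\<Sum>i\<in>UNIV. \<bar>v $ i\<bar> powr s"
  have "(?S powr (1 / s)) powr s = 1"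
    using assms by (simp add: lp_norm_def)
  then show ?thesis
    using assms(2) by (simp add: powr_powr sum_nonneg)
qed

text \<open>Young's inequality in each component; after summation the unit norms leave
  \<open>1 / s + 1 / t\<close>.\<close>

lemma Hoelder_normalized:
  fixes v w :: "real ^ 'd"
  assumes "1 < s" "1 < t" "1 / s + 1 / t = 1"
    and "lp_norm (ereal s) v = 1" "lp_norm (ereal t) w = 1"
  shows "v \<bullet> w \<le> 1"
proof -
  have "v \<bullet> w \<le> (\<Sum>i\<in>UNIV. \<bar>v $ i\<bar> powr s / s + \<bar>w $ i\<bar> powr t / t)"
    unfolding inner_vec_def
  proof (rule sum_mono)
    fix i :: 'd
    have "v $ i \<bullet> w $ i \<le> \<bar>v $ i\<bar> * \<bar>w $ i\<bar>"
      by (simp flip: abs_mult)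
    also have "\<dots> \<le> \<bar>v $ i\<bar> powr s / s + \<bar>w $ i\<bar> powr t / t"
      using assms by (intro Youngs_inequality) auto
    finally show "v $ i \<bullet> w $ i \<le> \<bar>v $ i\<bar> powr s / s + \<bar>w $ i\<bar> powr t / t" .
  qed
  also have "\<dots> = 1"
    using assms by (simp add: sum.distrib sum_powr_eq_1_if_lp_norm_eq_1 flip: sum_divide_distrib)
  finally show ?thesis .
qed

lemma conjugate_exponents_cases:
  fixes p q :: ereal
  assumes "1 \<le> p" "1 \<le> q" "1 / p + 1 / q = 1"
  obtains "p = 1" "q = \<infinity>" | "p = \<infinity>" "q = 1"
    | s t where "p = ereal s" "q = ereal t" "1 < s" "1 < t" "1 / s + 1 / t = 1"
proof -
  consider "p = \<infinity>" | s where "p = ereal s" "1 \<le> s"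
    using assms(1) by (rule ereal_ge_1_cases)
  then show ?thesis
  proof cases
    case 1
    from assms(2) show ?thesis
    proof (cases rule: ereal_ge_1_cases)
      case 1
      \<comment> \<open>Impossible: both reciprocals would be 0 in the extended reals.\<close>
      with \<open>p = \<infinity>\<close> assms(3) show ?thesis by simp
    next
      case (2 t)
      with \<open>p = \<infinity>\<close> assms(3) have "t = 1" by (simp add: one_ereal_def)
      with 2 \<open>p = \<infinity>\<close> that(2) show ?thesis by (simp add: one_ereal_def)
    qed
  next
    case p: (2 s)
    from assms(2) show ?thesis
    proof (cases rule: ereal_ge_1_cases)
      case 1
      with p assms(3) have "s = 1" by (simp add: one_ereal_def)
      with 1 p that(1) show ?thesis by (simp add: one_ereal_def)
    next
      case (2 t)
      with p assms(3) have eq: "1 / s + 1 / t = 1" by (simp add: one_ereal_def)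
      \<comment> \<open>An exponent 1 would force the reciprocal of the other, finite exponent to be
        0.\<close>
      moreover from eq p 2 have "s \<noteq> 1" "t \<noteq> 1" by auto
      ultimately show ?thesis using p 2 that(3) by simp
    qed
  qed
qed

text \<open>Both sides scale alike in \<open>v\<close> and \<open>w\<close>, so for finite exponents
  normalization suffices; zero vectors are split off because they cannot be normalized.\<close>

lemma Hoelder_lp_norm:
  fixes v w :: "real ^ 'd"
  assumes "1 \<le> p" "1 \<le> q" "1 / p + 1 / q = 1"
  shows "v \<bullet> w \<le> lp_norm p v * lp_norm q w"
  using assms
proof (cases rule: conjugate_exponents_cases)
  case 1
  then show ?thesis using Hoelder_one_infinity by simp
next
  case 2
  then show ?thesis using Hoelder_one_infinity[of w v] by (simp add: inner_commute mult.commute)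
next
  case (3 s t)
  show ?thesis
  proof (cases "v = 0 \<or> w = 0")
    case True
    then show ?thesis using assms by (auto simp: lp_norm_zero)
  next
    case False
    let ?a = "lp_norm p v" and ?b = "lp_norm q w"
    have pos: "0 < ?a" "0 < ?b"
      using False assms lp_norm_nonneg[of p v] lp_norm_nonneg[of q w]
      by (auto simp: less_le lp_norm_eq_0_iff)
    have "((1 / ?a) *\<^sub>R v) \<bullet> ((1 / ?b) *\<^sub>R w) \<le> 1"
      using 3 False assms lp_norm_normalize[of p v] lp_norm_normalize[of q w]
      by (intro Hoelder_normalized[of s t]) auto
    then show ?thesis
      using pos by (simp add: field_simps)
  qed
qed

lemma Hoelder_lp_norm_abs:
  fixes v w :: "real ^ 'd"
  assumes "1 \<le> p" "1 \<le> q" "1 / p + 1 / q = 1"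
  shows "\<bar>v \<bullet> w\<bar> \<le> lp_norm p v * lp_norm q w"
  using Hoelder_lp_norm[OF assms, of v w] Hoelder_lp_norm[OF assms, of "-v" w]
    lp_norm_scaleR[OF assms(1), of "-1" v]
  by simp

section \<open>Estimates by the operator norm\<close>

lemma lp_norm_matrix_vector_le:
  fixes H :: "real ^ 'd ^ 'd"
  assumes "1 \<le> p" "1 \<le> q"
  shows "lp_norm q (H *v v) \<le> op_norm p q H * lp_norm p v"
proof (cases "v = 0")
  case True
  then show ?thesis using assms by (simp add: lp_norm_zero)
next
  case False
  have pos: "0 < lp_norm p v"
    using False assms(1) lp_norm_nonneg[of p v] by (auto simp: less_le lp_norm_eq_0_iff)
  have "lp_norm q (H *v ((1 / lp_norm p v) *\<^sub>R v)) \<le> op_norm p q H"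
    by (rule op_norm_attained(2)[OF assms lp_norm_normalize[OF assms(1) False]])
  then show ?thesis
    using pos by (simp add: matrix_vector_mult_scaleR lp_norm_scaleR assms(2) field_simps)
qed

lemma op_norm_nonneg:
  assumes "1 \<le> p" "1 \<le> q"
  shows "0 \<le> op_norm p q H"
  using op_norm_attained(1)[OF assms, of H] lp_norm_nonneg[OF assms(2)] by metis


section \<open>Gradients and Hessians\<close>

text \<open>\<open>gradient\<close> stores the derivative on the standard basis; linearity recovers
  the whole map.\<close>

lemma has_derivative_gradient:
  fixes g :: "real ^ 'd \<Rightarrow> real"
  assumes "g differentiable (at y)"
  shows "(g has_derivative (\<lambda>h. gradient g y \<bullet> h)) (at y)"
proof -
  let ?D = "frechet_derivative g (at y)"
  have D: "(g has_derivative ?D) (at y)"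
    using assms by (simp add: frechet_derivative_works)
  have "?D h = gradient g y \<bullet> h" for h
  proof -
    have lin: "linear ?D"
      using D by (rule has_derivative_linear)
    have "?D h = ?D (\<Sum>i\<in>UNIV. h $ i *s axis i 1)"
      by (simp add: basis_expansion)
    also have "\<dots> = (\<Sum>i\<in>UNIV. h $ i * ?D (axis i 1))"
      by (simp add: linear_sum[OF lin] linear_cmul[OF lin] scalar_mult_eq_scaleR)
    finally show ?thesis
      by (simp add: gradient_def inner_vec_def mult.commute)
  qed
  then have "?D = (\<lambda>h. gradient g y \<bullet> h)" by blast
  with D show ?thesis by simp
qed

lemma has_derivative_gradient_unique:
  fixes g :: "real ^ 'd \<Rightarrow> real"
  assumes "(g has_derivative (\<lambda>h. v \<bullet> h)) (at y)"
  shows "gradient g y = v"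
  by (simp add: gradient_def vec_eq_iff inner_axis flip: frechet_derivative_at[OF assms])

lemma twice_continuously_differentiableD:
  assumes "twice_continuously_differentiable g"
  shows "(g has_derivative (\<lambda>h. gradient g y \<bullet> h)) (at y)"
    and "(gradient g has_derivative (\<lambda>h. hessian g y *v h)) (at y)"
  using assms
  by (auto simp: twice_continuously_differentiable_def differentiable_on_def hessian_def
      jacobian_works[symmetric] intro: has_derivative_gradient)

text \<open>Carries the regularity of the two score components over to \<open>f\<close>. Uniqueness
  of derivatives identifies the gradient of the difference first, and from it the Hessian.\<close>

lemma twice_continuously_differentiable_diff:
  fixes g h :: "real ^ 'd \<Rightarrow> real"
  assumes g: "twice_continuously_differentiable g" and h: "twice_continuously_differentiable h"
  shows "twice_continuously_differentiable (\<lambda>y. g y - h y)"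
proof -
  let ?k = "\<lambda>y. g y - h y"
  have deriv: "(?k has_derivative (\<lambda>v. (gradient g y - gradient h y) \<bullet> v)) (at y)" for y
    using has_derivative_diff[OF twice_continuously_differentiableD(1)[OF g]
        twice_continuously_differentiableD(1)[OF h]]
    by (simp add: inner_diff_left)
  then have grad: "gradient ?k = (\<lambda>y. gradient g y - gradient h y)"
    by (intro ext has_derivative_gradient_unique)
  have deriv2: "(gradient ?k has_derivative (\<lambda>v. (hessian g y - hessian h y) *v v)) (at y)" for y
    unfolding grad
    using has_derivative_diff[OF twice_continuously_differentiableD(2)[OF g]
        twice_continuously_differentiableD(2)[OF h]]
    by (simp add: matrix_vector_mult_diff_rdistrib)
  have "hessian ?k y = hessian g y - hessian h y" for y
    unfolding hessian_def[of ?k] jacobian_def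
    by (simp flip: frechet_derivative_at[OF deriv2])
  then have hess: "hessian ?k = (\<lambda>y. hessian g y - hessian h y)"
    by blast
  show ?thesis
    unfolding twice_continuously_differentiable_def
  proof (intro conjI)
    show "?k differentiable_on UNIV" "gradient ?k differentiable_on UNIV"
      using deriv deriv2 by (auto simp: differentiable_on_def differentiable_def)
    show "continuous_on UNIV (hessian ?k)"
      using g h unfolding hess twice_continuously_differentiable_def
      by (intro continuous_on_diff) auto
  qed
qed

text \<open>Restricting \<open>g\<close> to the segment from \<open>x\<close> to
  \<open>x + v\<close> reduces the claim to the one-variable Maclaurin theorem at 1 with a remainder
  of order two.\<close>

lemma Taylor_second_order:
  fixes g :: "real ^ 'd \<Rightarrow> real"
  assumes g: "twice_continuously_differentiable g"
  obtains t where "0 < t" "t < 1"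
    "g (x + v) = g x + gradient g x \<bullet> v + (hessian g (x + t *\<^sub>R v) *v v) \<bullet> v / 2"
proof -
  let ?l = "\<lambda>t. x + t *\<^sub>R v"
  \<comment> \<open>For \<open>n\<close> up to 2, \<open>u n\<close> is the n-th derivative of
    \<open>g\<close> along the segment.\<close>
  define u where "u n t = (if n = 0 then g (?l t) else if n = 1 then gradient g (?l t) \<bullet> v
    else (hessian g (?l t) *v v) \<bullet> v)" for n :: nat and t :: real
  have l: "(?l has_derivative (\<lambda>h. h *\<^sub>R v)) (at t)" for t
    by (auto intro!: derivative_eq_intros)
  have "DERIV (u m) t :> u (Suc m) t" if "m < 2" for m t
  proof -
    consider "m = 0" | "m = 1" using \<open>m < 2\<close> by linarith
    then show ?thesis
    proof cases
      case 1
      have "((\<lambda>t. g (?l t)) has_derivative (\<lambda>h. gradient g (?l t) \<bullet> (h *\<^sub>R v))) (at t)"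
        by (rule has_derivative_compose[OF l twice_continuously_differentiableD(1)[OF g]])
      then show ?thesis
        by (simp add: 1 u_def[abs_def] has_field_derivative_def mult_commute_abs)
    next
      case 2
      have "((\<lambda>t. gradient g (?l t)) has_derivative (\<lambda>h. hessian g (?l t) *v (h *\<^sub>R v))) (at t)"
        by (rule has_derivative_compose[OF l twice_continuously_differentiableD(2)[OF g]])
      then have "((\<lambda>t. gradient g (?l t) \<bullet> v) has_derivative
          (\<lambda>h. (hessian g (?l t) *v (h *\<^sub>R v)) \<bullet> v)) (at t)"
        by (rule has_derivative_inner_left)
      then show ?thesis
        by (simp add: 2 u_def[abs_def] has_field_derivative_def matrix_vector_mult_scaleR
            mult_commute_abs)
    qed
  qed
  then obtain t where "0 < t" "t < 1"
      "u 0 1 = (\<Sum>m<2. (u m 0 / fact m) * 1 ^ m) + (u 2 t / fact 2) * 1 ^ 2"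
    using Maclaurin[of 1 2 u "u 0"] by auto
  then show ?thesis
    by (intro that[of t]) (simp_all add: u_def numeral_2_eq_2)
qed


section \<open>The curvature and the radius bound\<close>

lemma curvature_nonneg:
  assumes "1 \<le> p" "1 \<le> q" "0 \<le> R" "twice_continuously_differentiable g"
  shows "0 \<le> curvature p q R g x"
  using curvature_attained(1)[OF assms, of x] op_norm_nonneg[OF assms(1,2)] by metis

text \<open>A maximizer over the smaller ball remains admissible in the larger one.\<close>

lemma curvature_mono:
  assumes "1 \<le> p" "1 \<le> q" "0 \<le> R" "R \<le> R'" "twice_continuously_differentiable g"
  shows "curvature p q R g x \<le> curvature p q R' g x"
proof -
  obtain \<gamma> where "lp_norm p \<gamma> \<le> R" "op_norm p q (hessian g (x + \<gamma>)) = curvature p q R g x"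
    using curvature_attained(1) assms by blast
  then show ?thesis
    using curvature_attained(2)[of p q R' g \<gamma> x] assms by simp
qed

text \<open>Rescaling the ball to radius 1 makes the index set independent of \<open>R\<close>, so that
  sublevel sets of the curvature become intersections of closed sets.\<close>

lemma curvature_le_iff:
  fixes g :: "real ^ 'd \<Rightarrow> real"
  assumes "1 \<le> p" "1 \<le> q" "0 \<le> R" "twice_continuously_differentiable g"
  shows "curvature p q R g x \<le> k \<longleftrightarrow>
    (\<forall>\<gamma> v. lp_norm p \<gamma> \<le> 1 \<longrightarrow> lp_norm p v = 1 \<longrightarrow>
      lp_norm q (hessian g (x + R *\<^sub>R \<gamma>) *v v) \<le> k)" (is "?L \<longleftrightarrow> ?R")
proof
  assume k: ?L
  show ?R
  proof (intro allI impI)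
    fix \<gamma> v :: "real ^ 'd"
    assume \<gamma>: "lp_norm p \<gamma> \<le> 1" and v: "lp_norm p v = 1"
    have "lp_norm q (hessian g (x + R *\<^sub>R \<gamma>) *v v) \<le> op_norm p q (hessian g (x + R *\<^sub>R \<gamma>))"
      using assms v by (intro op_norm_attained)
    also have "\<dots> \<le> curvature p q R g x"
      using assms \<gamma> by (intro curvature_attained) (auto simp: lp_norm_scaleR mult_left_le)
    finally show "lp_norm q (hessian g (x + R *\<^sub>R \<gamma>) *v v) \<le> k" using k by simp
  qed
next
  assume le: ?R
  obtain \<gamma> where \<gamma>: "lp_norm p \<gamma> \<le> R" "op_norm p q (hessian g (x + \<gamma>)) = curvature p q R g x"
    using curvature_attained(1) assms by blast
  obtain v where v: "lp_norm p v = 1"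
      "lp_norm q (hessian g (x + \<gamma>) *v v) = op_norm p q (hessian g (x + \<gamma>))"
    using op_norm_attained(1) assms by blast
  \<comment> \<open>For \<open>R = 0\<close> the ball is the single point 0, so the division by
    \<open>R\<close> has to be avoided there.\<close>
  have "\<exists>\<gamma>'. lp_norm p \<gamma>' \<le> 1 \<and> R *\<^sub>R \<gamma>' = \<gamma>"
  proof (cases "R = 0")
    case True
    then have "\<gamma> = 0"
      using \<gamma>(1) lp_norm_nonneg[OF assms(1), of \<gamma>] lp_norm_eq_0_iff[OF assms(1), of \<gamma>] by simp
    then show ?thesis
      using True by (intro exI[of _ 0]) (simp add: lp_norm_zero[OF assms(1)])
  next
    case False
    then show ?thesis
      using \<gamma>(1) assms by (intro exI[of _ "(1 / R) *\<^sub>R \<gamma>"]) (simp add: lp_norm_scaleR)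
  qed
  then obtain \<gamma>' where "lp_norm p \<gamma>' \<le> 1" "R *\<^sub>R \<gamma>' = \<gamma>" by blast
  with le v \<gamma>(2) show ?L by metis
qed

text \<open>Supplies the closedness from which a largest admissible radius is obtained. A bound on a
  supremum is a family of bounds on continuous functions of \<open>R\<close>, so continuity of the
  curvature in \<open>R\<close> never has to be proved.\<close>

lemma closed_radius_sublevel:
  fixes g :: "real ^ 'd \<Rightarrow> real"
  assumes "1 \<le> p" "1 \<le> q" "twice_continuously_differentiable g" "0 < c"
  shows "closed {R \<in> {0..r}. R * (a + R / 2 * curvature p q R g x) \<le> c}"
proof -
  let ?h = "\<lambda>\<gamma> v R. R * (a + R / 2 * lp_norm q (hessian g (x + R *\<^sub>R \<gamma>) *v v))"
  have hess: "continuous_on UNIV (hessian g)"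
    using assms(3) by (simp add: twice_continuously_differentiable_def)
  have eq: "R * (a + R / 2 * curvature p q R g x) \<le> c \<longleftrightarrow>
      (\<forall>\<gamma> v. lp_norm p \<gamma> \<le> 1 \<longrightarrow> lp_norm p v = 1 \<longrightarrow> ?h \<gamma> v R \<le> c)" if "0 \<le> R" for R
  proof (cases "R = 0")
    case True
    then show ?thesis using assms(4) by simp
  next
    case False
    with that have "0 < R" by simp
    \<comment> \<open>Solving for \<open>y\<close> turns the condition into an upper bound on the
      curvature, the form handled by \<open>curvature_le_iff\<close>.\<close>
    then have "R * (a + R / 2 * y) \<le> c \<longleftrightarrow> y \<le> (c / R - a) * 2 / R" for y
      by (simp add: field_simps)
    then show ?thesis
      using curvature_le_iff[OF assms(1,2) that assms(3)] by simp
  qed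
  have closed: "closed {R. ?h \<gamma> v R \<le> c}" for \<gamma> v
  proof -
    have "continuous_on UNIV (\<lambda>R. hessian g (x + R *\<^sub>R \<gamma>))"
      by (rule continuous_on_compose2[OF hess]) (auto intro!: continuous_intros)
    then have "continuous_on UNIV (\<lambda>R. hessian g (x + R *\<^sub>R \<gamma>) *v v)"
      unfolding matrix_vector_mult_def
      by (intro continuous_on_vec_lambda continuous_intros)
    then have "continuous_on UNIV (\<lambda>R. lp_norm q (hessian g (x + R *\<^sub>R \<gamma>) *v v))"
      by (rule continuous_on_lp_norm[OF assms(2)])
    then show ?thesis
      by (intro closed_Collect_le continuous_intros) auto
  qed
  have "{R \<in> {0..r}. R * (a + R / 2 * curvature p q R g x) \<le> c} =
      {0..r} \<inter> (\<Inter>\<gamma>\<in>{\<gamma>. lp_norm p \<gamma> \<le> 1}. \<Inter>v\<in>{v. lp_norm p v = 1}. {R. ?h \<gamma> v R \<le> c})"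
    using eq by auto
  also have "closed \<dots>"
    by (intro closed_Int closed_INT ballI closed closed_atLeastAtMost)
  finally show ?thesis .
qed

text \<open>Take \<open>s\<close> as the greatest element of the compact set \<open>?A\<close>.
  Beyond it \<open>t * D t\<close> is at least \<open>c\<close>, and monotonicity of
  \<open>D\<close> turns this into the mixed bound on \<open>s * D t\<close>.\<close>

lemma crossing_radius:
  fixes D :: "real \<Rightarrow> real"
  assumes mono: "\<And>s t. 0 \<le> s \<Longrightarrow> s \<le> t \<Longrightarrow> D s \<le> D t"
    and closed: "closed {t \<in> {0..r}. t * D t \<le> c}"
    and r: "0 < r" "c \<le> r * D r" and c: "0 < c"
  obtains s where "0 < s" "s \<le> r" "s * D s \<le> c" "\<And>t. s < t \<Longrightarrow> c \<le> s * D t"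
proof -
  let ?A = "{t \<in> {0..r}. t * D t \<le> c}"
  have "compact ?A"
    using closed by (auto simp: compact_eq_bounded_closed intro: bounded_subset[of "{0..r}"])
  moreover have "0 \<in> ?A" using r c by simp
  ultimately obtain s where s: "s \<in> ?A" and max: "\<And>t. t \<in> ?A \<Longrightarrow> t \<le> s"
    using compact_attains_sup[of ?A] by blast
  have Dr: "0 < D r"
    using r c by (smt (verit) zero_less_mult_pos)
  have "0 < s"
  proof -
    \<comment> \<open>A positive member of \<open>?A\<close>: since \<open>D t\<close> is at most
      \<open>D r\<close>, the cap \<open>c / D r\<close> keeps \<open>t * D t\<close> below
      \<open>c\<close>.\<close>
    define t where "t = min r (c / D r)"
    have t: "0 < t" "t \<le> r" using r c Dr by (auto simp: t_def)
    have "t * D t \<le> t * D r" using t by (intro mult_left_mono mono) auto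
    also have "\<dots> \<le> c / D r * D r" using Dr by (intro mult_right_mono) (auto simp: t_def)
    finally have "t \<in> ?A" using t Dr by simp
    then show ?thesis using max[of t] t by simp
  qed
  \<comment> \<open>Hold \<open>D t\<close> fixed and let \<open>u\<close> decrease to
    \<open>s\<close> in \<open>c \<le> u * D u \<le> u * D t\<close>; the limit involves only the
    factor \<open>u\<close>, so a jump of \<open>D\<close> at \<open>s\<close> does no harm.\<close>
  moreover have "c \<le> s * D t" if "s < t" for t
  proof (rule tendsto_lowerbound)
    show "((\<lambda>u. u * D t) \<longlongrightarrow> s * D t) (at_right s)"
      by (intro tendsto_intros)
    have "c \<le> u * D t" if u: "u \<in> {s<..<t}" for u
    proof -
      have "c \<le> u * D u"
      \<comment> \<open>Up to \<open>r\<close>, maximality of \<open>s\<close> excludes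
        \<open>u\<close> from \<open>?A\<close>; beyond \<open>r\<close>, monotonicity extends the
        bound known at \<open>r\<close>.\<close>
      proof (cases "u \<le> r")
        case True
        then show ?thesis using u max[of u] \<open>0 < s\<close> by fastforce
      next
        case False
        then have "r * D r \<le> u * D u"
          using r Dr u by (intro mult_mono mono) auto
        with r show ?thesis by simp
      qed
      also have "\<dots> \<le> u * D t"
        using u \<open>0 < s\<close> by (intro mult_left_mono mono) auto
      finally show ?thesis .
    qed
    then show "\<forall>\<^sub>F u in at_right s. c \<le> u * D t"
      using \<open>s < t\<close> by (auto simp: eventually_at_right)
  qed simp
  ultimately show ?thesis
    using that s by simp
qed

section \<open>The Taylor estimate and the maximal radius\<close>

lemma Taylor_lower_bound:
  fixes g :: "real ^ 'd \<Rightarrow> real" and x \<delta> :: "real ^ 'd"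
  assumes pq: "1 \<le> p" "1 \<le> q" "1 / p + 1 / q = 1"
    and g: "twice_continuously_differentiable g"
  defines "r \<equiv> lp_norm p \<delta>"
  shows "g x \<le> g (x + \<delta>) + r * (lp_norm q (gradient g x) + r / 2 * curvature p q r g x)"
proof -
  have r: "0 \<le> r" unfolding r_def by (rule lp_norm_nonneg[OF pq(1)])
  obtain t where t: "0 < t" "t < 1"
    and eq: "g (x + \<delta>) = g x + gradient g x \<bullet> \<delta> + (hessian g (x + t *\<^sub>R \<delta>) *v \<delta>) \<bullet> \<delta> / 2"
    using Taylor_second_order[OF g] by blast
  let ?H = "hessian g (x + t *\<^sub>R \<delta>)"
  have lin: "\<bar>gradient g x \<bullet> \<delta>\<bar> \<le> r * lp_norm q (gradient g x)"
    using Hoelder_lp_norm_abs[OF pq, of \<delta> "gradient g x"] by (simp add: r_def inner_commute)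
  \<comment> \<open>The intermediate point stays in the ball of radius \<open>r\<close>, so the
    curvature at \<open>r\<close> controls its Hessian.\<close>
  have "lp_norm p (t *\<^sub>R \<delta>) \<le> r"
    using t r pq by (simp add: lp_norm_scaleR r_def mult_left_le_one_le)
  then have "op_norm p q ?H \<le> curvature p q r g x"
    using pq r g by (intro curvature_attained(2))
  then have "lp_norm q (?H *v \<delta>) \<le> curvature p q r g x * r"
    using lp_norm_matrix_vector_le[OF pq(1,2), of ?H \<delta>] r
    by (fold r_def) (smt (verit) mult_right_mono)
  then have "r * lp_norm q (?H *v \<delta>) \<le> r * (curvature p q r g x * r)"
    using r by (intro mult_left_mono)
  \<comment> \<open>Hoelder contributes one factor \<open>r\<close>, the operator norm the
    other.\<close>
  with Hoelder_lp_norm_abs[OF pq, of \<delta> "?H *v \<delta>"]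
  have quad: "\<bar>(?H *v \<delta>) \<bullet> \<delta>\<bar> \<le> r * (curvature p q r g x * r)"
    by (simp add: r_def inner_commute)
  show ?thesis
    using lin quad unfolding eq by (simp add: algebra_simps)
qed

text \<open>In the index type \<open>2\<close>, \<open>0\<close> and \<open>1\<close> are the two
  distinct elements. Attainment is included so that the supremum is a genuine maximum.\<close>

theorem theorem2:
  fixes F :: "real ^ 'd \<Rightarrow> real ^ 2"
    and f :: "real ^ 'd \<Rightarrow> real"
    and x \<delta> :: "real ^ 'd"
    and p q :: ereal
  assumes "twice_continuously_differentiable (\<lambda>y. F y $ 0)"
    and "twice_continuously_differentiable (\<lambda>y. F y $ 1)"
    and "F x $ 0 > F x $ 1"
    and "f = (\<lambda>y. F y $ 0 - F y $ 1)"
    and "1 \<le> p" and "1 \<le> q" and "1 / p + 1 / q = 1"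
    and "F (x + \<delta>) $ 1 \<ge> F (x + \<delta>) $ 0"
  shows "(\<exists>R>0. radius_bound p q f x R = (SUP R\<in>{0<..}. radius_bound p q f x R)) \<and>
    ereal (lp_norm p \<delta>) \<ge> (SUP R\<in>{0<..}. radius_bound p q f x R)"
proof -
  note pq = assms(5-7)
  have f: "twice_continuously_differentiable f"
    using assms(1,2,4) by (simp add: twice_continuously_differentiable_diff)
  have c: "0 < f x" and neg: "f (x + \<delta>) \<le> 0"
    using assms(3,4,8) by auto
  define D where "D R = lp_norm q (gradient f x) + R / 2 * curvature p q R f x" for R
  let ?r = "lp_norm p \<delta>"
  have D_nonneg: "0 \<le> D R" if "0 \<le> R" for R
    using that pq f unfolding D_def
    by (intro add_nonneg_nonneg mult_nonneg_nonneg lp_norm_nonneg curvature_nonneg) auto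
  have D_mono: "D R \<le> D R'" if "0 \<le> R" "R \<le> R'" for R R'
    unfolding D_def using that pq f
    by (intro add_left_mono mult_mono curvature_mono curvature_nonneg) auto
  have cross: "f x \<le> ?r * D ?r"
    using Taylor_lower_bound[OF pq f, of x \<delta>] neg by (simp add: D_def)
  \<comment> \<open>Radius 0 would make the right side of \<open>cross\<close> vanish.\<close>
  with c have r: "0 < ?r"
    using lp_norm_nonneg[OF pq(1), of \<delta>] by (auto simp: less_le)
  obtain s where s: "0 < s" "s \<le> ?r" "s * D s \<le> f x" "\<And>t. s < t \<Longrightarrow> f x \<le> s * D t"
    using crossing_radius[of D ?r "f x", OF D_mono _ r cross c]
      closed_radius_sublevel[OF pq(1,2) f c] by (auto simp: D_def)
  have bound: "radius_bound p q f x R = min (ereal R) (ereal (f x) / ereal (D R))" for R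
    by (simp add: radius_bound_def D_def)
  have at_s: "radius_bound p q f x s = ereal s"
  proof (cases "D s = 0")
    \<comment> \<open>The quotient is infinite here, so the minimum is \<open>s\<close>.\<close>
    case True
    with c show ?thesis by (simp add: bound divide_ereal_def)
  next
    case False
    then have "0 < D s" using D_nonneg[of s] s by simp
    then show ?thesis using s by (simp add: bound min_def field_simps)
  qed
  have "radius_bound p q f x t \<le> ereal s" if "0 < t" for t
  \<comment> \<open>Up to \<open>s\<close> the first argument of the minimum gives the bound, beyond
    \<open>s\<close> the quotient does.\<close>
  proof (cases "t \<le> s")
    case True
    then show ?thesis by (simp add: bound min.coboundedI1)
  next
    case False
    then have t: "f x \<le> s * D t" using s by simp
    with c s have "0 < D t" by (smt (verit) zero_less_mult_pos)
    with t have "ereal (f x) / ereal (D t) \<le> ereal s" by (simp add: field_simps)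
    then show ?thesis by (simp add: bound min.coboundedI2)
  qed
  then have "(SUP R\<in>{0<..}. radius_bound p q f x R) = ereal s"
    using s(1) at_s by (intro antisym SUP_least SUP_upper2[of s]) auto
  with at_s s show ?thesis by auto
qed

end
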